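(* Let $k$ be a nonzero commutative unital ring. The unital associative $k$-algebra defined by generators $t,s$ and relations $stst=tsts$, $t^3=0$, $s^2=s$ is not finitely generated as a $k$-module. *)

theory Defs
  imports Complex_Main "HOL-Library.Poly_Mapping"
begin

datatype gen = T | S

text \<open>The free monoid on the two generators, written additively (concatenation is \<open>+\<close>, the empty
  word is \<open>0\<close>) so that finitely supported functions on it carry the convolution product of
  \<open>Poly_Mapping\<close>; hence \<open>gen_word \<Rightarrow>\<^sub>0 'k\<close> is the free unital associative algebra on \<open>t\<close>, \<open>s\<close>.\<close>

datatype gen_word = Gen_Word "gen list"

instantiation gen_word :: monoid_add
begin

definition zero_gen_word :: gen_word where
  "0 = Gen_Word []"

fun plus_gen_word :: "gen_word \<Rightarrow> gen_word \<Rightarrow> gen_word" where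
  "Gen_Word u + Gen_Word v = Gen_Word (u @ v)"

instance
proof
  fix a b c :: gen_word
  show "a + b + c = a + (b + c)" by (cases a; cases b; cases c) simp
  show "0 + a = a" by (cases a) (simp add: zero_gen_word_def)
  show "a + 0 = a" by (cases a) (simp add: zero_gen_word_def)
qed

end

type_synonym 'k free_alg = "gen_word \<Rightarrow>\<^sub>0 'k"

definition free_scale :: "'k::comm_ring_1 \<Rightarrow> 'k free_alg \<Rightarrow> 'k free_alg" where
  "free_scale c x = Poly_Mapping.map ((*) c) x"

definition free_gen :: "gen \<Rightarrow> 'k::comm_ring_1 free_alg" where
  "free_gen g = Poly_Mapping.single (Gen_Word [g]) 1"

inductive_set two_sided_ideal :: "'a::ring_1 set \<Rightarrow> 'a set" for R where
  zero: "0 \<in> two_sided_ideal R"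
| gen: "r \<in> R \<Longrightarrow> r \<in> two_sided_ideal R"
| add: "x \<in> two_sided_ideal R \<Longrightarrow> y \<in> two_sided_ideal R \<Longrightarrow> x + y \<in> two_sided_ideal R"
| mult: "x \<in> two_sided_ideal R \<Longrightarrow> a * x * b \<in> two_sided_ideal R"

definition relators :: "'k::comm_ring_1 free_alg set" where
  "relators = (let t = free_gen T; s = free_gen S in
     {s * t * s * t - t * s * t * s, t ^ 3, s ^ 2 - s})"

definition rel_cong :: "'k::comm_ring_1 free_alg \<Rightarrow> 'k free_alg \<Rightarrow> bool" where
  "rel_cong x y \<longleftrightarrow> x - y \<in> two_sided_ideal relators"

lemma two_sided_ideal_mult_left: "x \<in> two_sided_ideal R \<Longrightarrow> a * x \<in> two_sided_ideal R"
  using two_sided_ideal.mult[of x R a 1] by simp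

lemma two_sided_ideal_mult_right: "x \<in> two_sided_ideal R \<Longrightarrow> x * b \<in> two_sided_ideal R"
  using two_sided_ideal.mult[of x R 1 b] by simp

lemma two_sided_ideal_uminus: "x \<in> two_sided_ideal R \<Longrightarrow> - x \<in> two_sided_ideal R"
  using two_sided_ideal_mult_left[of x R "- 1"] by simp

lemma lookup_free_scale [simp]:
  "Poly_Mapping.lookup (free_scale c x) w = c * Poly_Mapping.lookup x w"
  unfolding free_scale_def by (simp add: Poly_Mapping.map.rep_eq when_def)

lemma poly_mapping_single_induct [case_names single sum]:
  fixes x :: "'a \<Rightarrow>\<^sub>0 'b::monoid_add"
  assumes single: "\<And>w a. P (Poly_Mapping.single w a)"
    and sum: "\<And>f w a. P f \<Longrightarrow> P (f + Poly_Mapping.single w a)"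
  shows "P x"
proof (induction x rule: update_induct)
  case const
  show ?case using single[of _ 0] by simp
next
  case (update f a b)
  have "Poly_Mapping.update a b f = f + Poly_Mapping.single a b"
    using update.hyps
    by (intro poly_mapping_eqI)
      (auto simp: lookup_update lookup_add lookup_single when_def in_keys_iff)
  with sum[OF update.IH] show ?case by simp
qed

lemma free_scale_conv_mult: "free_scale c x = Poly_Mapping.single 0 c * x"
proof (induction x rule: poly_mapping_single_induct)
  case (single w a)
  show ?case
    by (rule poly_mapping_eqI) (simp add: mult_single lookup_single when_def)
next
  case (sum f w a)
  have "free_scale c (f + Poly_Mapping.single w a)
      = free_scale c f + Poly_Mapping.single 0 c * Poly_Mapping.single w a"
    by (rule poly_mapping_eqI) (simp add: lookup_add distrib_left mult_single lookup_single when_def)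
  with sum show ?case by (simp add: distrib_left)
qed

lemma free_scale_mult_left: "free_scale c x * y = free_scale c (x * y)"
  by (simp add: free_scale_conv_mult mult.assoc)

lemma single_zero_central:
  "Poly_Mapping.single 0 c * x = x * Poly_Mapping.single 0 c"
  for x :: "'k::comm_ring_1 free_alg"
proof (induction x rule: poly_mapping_single_induct)
  case (single w a)
  show ?case by (simp add: mult_single mult.commute)
next
  case (sum f w a)
  then show ?case by (simp add: distrib_left distrib_right mult_single mult.commute)
qed

lemma free_scale_mult_right: "x * free_scale c y = free_scale c (x * y)"
  using single_zero_central[of c x] by (simp add: free_scale_conv_mult flip: mult.assoc)

lemma equivp_rel_cong: "equivp (rel_cong :: 'k::comm_ring_1 free_alg \<Rightarrow> _)"
proof (rule equivpI)
  show "reflp (rel_cong :: 'k free_alg \<Rightarrow> _)"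
    by (simp add: reflp_def rel_cong_def two_sided_ideal.zero)
  show "symp (rel_cong :: 'k free_alg \<Rightarrow> _)"
    unfolding symp_def rel_cong_def
    using two_sided_ideal_uminus by fastforce
  show "transp (rel_cong :: 'k free_alg \<Rightarrow> _)"
    unfolding transp_def rel_cong_def
  proof (intro allI impI)
    fix x y z :: "'k free_alg"
    assume "x - y \<in> two_sided_ideal relators" "y - z \<in> two_sided_ideal relators"
    from two_sided_ideal.add[OF this] show "x - z \<in> two_sided_ideal relators" by simp
  qed
qed

quotient_type (overloaded) 'k presented_alg = "'k::comm_ring_1 free_alg" / rel_cong
  by (rule equivp_rel_cong)

instantiation presented_alg :: (comm_ring_1) ring
begin

lift_definition zero_presented_alg :: "'a presented_alg" is 0 .

lift_definition plus_presented_alg :: "'a presented_alg \<Rightarrow> 'a presented_alg \<Rightarrow> 'a presented_alg"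
  is "(+)"
proof -
  fix a b c d :: "'a free_alg"
  assume "rel_cong a b" "rel_cong c d"
  then have "(a - b) + (c - d) \<in> two_sided_ideal relators"
    unfolding rel_cong_def by (rule two_sided_ideal.add)
  then show "rel_cong (a + c) (b + d)"
    unfolding rel_cong_def by (simp add: algebra_simps)
qed

lift_definition uminus_presented_alg :: "'a presented_alg \<Rightarrow> 'a presented_alg" is uminus
  unfolding rel_cong_def using two_sided_ideal_uminus by fastforce

lift_definition minus_presented_alg :: "'a presented_alg \<Rightarrow> 'a presented_alg \<Rightarrow> 'a presented_alg"
  is "(-)"
proof -
  fix a b c d :: "'a free_alg"
  assume "rel_cong a b" "rel_cong c d"
  then have "(a - b) + - (c - d) \<in> two_sided_ideal relators"
    unfolding rel_cong_def by (intro two_sided_ideal.add two_sided_ideal_uminus)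
  then show "rel_cong (a - c) (b - d)"
    unfolding rel_cong_def by (simp add: algebra_simps)
qed

lift_definition times_presented_alg :: "'a presented_alg \<Rightarrow> 'a presented_alg \<Rightarrow> 'a presented_alg"
  is "(*)"
proof -
  fix a b c d :: "'a free_alg"
  assume "rel_cong a b" "rel_cong c d"
  then have "(a - b) * c + b * (c - d) \<in> two_sided_ideal relators"
    unfolding rel_cong_def
    by (intro two_sided_ideal.add two_sided_ideal_mult_left two_sided_ideal_mult_right)
  then show "rel_cong (a * c) (b * d)"
    unfolding rel_cong_def by (simp add: algebra_simps)
qed

instance
proof
  have eq: "x = y \<Longrightarrow> rel_cong x y" for x y :: "'a free_alg"
    by (simp add: rel_cong_def two_sided_ideal.zero)
  fix a b c :: "'a presented_alg"
  show "a + b + c = a + (b + c)" by transfer (rule eq, simp add: algebra_simps)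
  show "a + b = b + a" by transfer (rule eq, simp add: algebra_simps)
  show "0 + a = a" by transfer (rule eq, simp)
  show "- a + a = 0" by transfer (rule eq, simp)
  show "a - b = a + - b" by transfer (rule eq, simp)
  show "a * b * c = a * (b * c)" by transfer (rule eq, simp add: mult.assoc)
  show "(a + b) * c = a * c + b * c" by transfer (rule eq, simp add: algebra_simps)
  show "a * (b + c) = a * b + a * c" by transfer (rule eq, simp add: algebra_simps)
qed

end

text \<open>\<open>ring_1\<close> would require \<open>0 \<noteq> 1\<close>, a fact about this particular presentation; \<open>monoid_mult\<close>
  together with \<open>ring\<close> is what holds by construction.\<close>

instantiation presented_alg :: (comm_ring_1) monoid_mult
begin

lift_definition one_presented_alg :: "'a presented_alg" is 1 .

instance
proof
  have eq: "x = y \<Longrightarrow> rel_cong x y" for x y :: "'a free_alg"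
    by (simp add: rel_cong_def two_sided_ideal.zero)
  fix a b c :: "'a presented_alg"
  show "1 * a = a" by transfer (rule eq, simp)
  show "a * 1 = a" by transfer (rule eq, simp)
qed

end

lift_definition alg_scale :: "'k::comm_ring_1 \<Rightarrow> 'k presented_alg \<Rightarrow> 'k presented_alg"
  is free_scale
  unfolding rel_cong_def free_scale_conv_mult right_diff_distrib[symmetric]
  by (rule two_sided_ideal_mult_left)

lift_definition alg_gen :: "gen \<Rightarrow> 'k::comm_ring_1 presented_alg" is free_gen .

lemma module_alg_scale: "module (alg_scale :: 'k::comm_ring_1 \<Rightarrow> _)"
proof
  have eq: "x = y \<Longrightarrow> rel_cong x y" for x y :: "'k free_alg"
    by (simp add: rel_cong_def two_sided_ideal.zero)
  fix a b :: 'k and x y :: "'k presented_alg"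
  show "alg_scale a (x + y) = alg_scale a x + alg_scale a y"
    by transfer (rule eq, simp add: free_scale_conv_mult distrib_left)
  show "alg_scale (a + b) x = alg_scale a x + alg_scale b x"
    by transfer (rule eq, simp add: free_scale_conv_mult distrib_right single_add)
  show "alg_scale a (alg_scale b x) = alg_scale (a * b) x"
    by transfer (rule eq, rule poly_mapping_eqI, simp add: mult.assoc)
  show "alg_scale 1 x = x"
    by transfer (rule eq, rule poly_mapping_eqI, simp)
qed

lemma alg_scale_mult_left: "alg_scale c x * y = alg_scale c (x * y)"
  by transfer (simp add: free_scale_mult_left rel_cong_def two_sided_ideal.zero)

lemma alg_scale_mult_right: "x * alg_scale c y = alg_scale c (x * y)"
  by transfer (simp add: free_scale_mult_right rel_cong_def two_sided_ideal.zero)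

lemma alg_gen_relations:
  fixes s t :: "'k::comm_ring_1 presented_alg"
  defines "s \<equiv> alg_gen S" and "t \<equiv> alg_gen T"
  shows "s * t * s * t = t * s * t * s" "t ^ 3 = 0" "s ^ 2 = s"
proof -
  show "s * t * s * t = t * s * t * s"
    unfolding s_def t_def
    by transfer (auto simp: rel_cong_def relators_def Let_def intro: two_sided_ideal.gen)
  have "alg_gen T * alg_gen T * alg_gen T = (0 :: 'k presented_alg)"
    by transfer
      (auto simp: rel_cong_def relators_def Let_def power3_eq_cube intro: two_sided_ideal.gen)
  then show "t ^ 3 = 0"
    unfolding t_def by (simp add: power3_eq_cube)
  have "alg_gen S * alg_gen S = (alg_gen S :: 'k presented_alg)"
    by transfer
      (auto simp: rel_cong_def relators_def Let_def power2_eq_square intro: two_sided_ideal.gen)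
  then show "s ^ 2 = s"
    unfolding s_def by (simp add: power2_eq_square)
qed

definition finitely_generated_module ::
    "('k::comm_ring_1 \<Rightarrow> 'm::ab_group_add \<Rightarrow> 'm) \<Rightarrow> bool" where
  "finitely_generated_module scale \<longleftrightarrow> (\<exists>B. finite B \<and> module.span scale B = UNIV)"

end

theory Submission
  imports Defs
begin

text \<open>Why the algebra is infinite: every relation either identifies two words or kills one. In the
  words \<open>(stt)\<^sup>n\<close> neither \<open>stst\<close>, \<open>tsts\<close> nor \<open>ttt\<close> occurs, not even after some letters \<open>s\<close> have been
  repeated, so the relations can do nothing to these words except repeat letters \<open>s\<close>. Hence they
  ought to be independent in the quotient.

  This is made rigorous without solving the word problem, by an infinite representation. The infinite
  path \<open>s t t s t t \<dots>\<close>, with a loop \<open>s\<close> added at the end of each of its \<open>s\<close>-edges, is a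
  deterministic partial automaton with state set \<open>nat\<close>; reading a word acts on states, hence on
  functions on states, and the relations hold for this action (\<open>act_ideal\<close>). In the resulting
  module each element of the algebra carries the functions supported at a state \<open>q\<close> to functions
  vanishing at \<open>0\<close>, for all but finitely many \<open>q\<close> (\<open>finite_reach\<close>). For finitely many elements, and
  so for their span, a common \<open>q\<close> can be chosen, whereas the word labelling the path from \<open>0\<close> to \<open>q\<close>
  violates the vanishing. This argument is linear over any coefficient ring in which \<open>0 \<noteq> 1\<close>.\<close>

text \<open>\<open>None\<close> means that the letter cannot be read. The second branch for \<open>S\<close> is the loop that
  makes \<open>s\<close> idempotent: it sits at the states reached by an \<open>s\<close>-edge.\<close>

fun step :: "gen \<Rightarrow> nat \<Rightarrow> nat option" where
  "step S p = (if p mod 3 = 0 then Some (p + 1) else if p mod 3 = 1 then Some p else None)"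
| "step T p = (if p mod 3 = 0 then None else Some (p + 1))"

fun run_list :: "gen list \<Rightarrow> nat \<Rightarrow> nat option" where
  "run_list [] p = Some p"
| "run_list (g # w) p = Option.bind (step g p) (run_list w)"

fun run :: "gen_word \<Rightarrow> nat \<Rightarrow> nat option" where
  "run (Gen_Word w) = run_list w"

lemma run_list_append: "run_list (u @ v) p = Option.bind (run_list u p) (run_list v)"
proof (induction u arbitrary: p)
  case (Cons g u)
  then show ?case by (cases "step g p") simp_all
qed simp

lemma run_plus: "run (u + v) p = Option.bind (run u p) (run v)"
  by (cases u; cases v) (simp add: run_list_append)

text \<open>The vanishing of the three words is what makes the relations hold: the path never has a single
  \<open>t\<close> between two letters \<open>s\<close>, and never three letters \<open>t\<close> in a row.\<close>

lemma run_list_relations: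
  "run_list [S, T, S, T] p = None"
  "run_list [T, S, T, S] p = None"
  "run_list [T, T, T] p = None"
  "run_list [S, S] p = run_list [S] p"
proof -
  have "p mod 3 = 0 \<or> p mod 3 = 1 \<or> p mod 3 = 2" by presburger
  then show
    "run_list [S, T, S, T] p = None"
    "run_list [T, S, T, S] p = None"
    "run_list [T, T, T] p = None"
    "run_list [S, S] p = run_list [S] p"
    by (auto simp: mod_Suc)
qed

lemma every_state_reachable: "\<exists>w. run w 0 = Some q"
proof -
  have "\<exists>w. run_list w 0 = Some q"
  proof (induction q)
    case 0
    have "run_list [] 0 = Some 0" by simp
    then show ?case ..
  next
    case (Suc q)
    then obtain w where "run_list w 0 = Some q" ..
    then have "run_list (w @ [if q mod 3 = 0 then S else T]) 0 = Some (Suc q)"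
      by (simp add: run_list_append)
    then show ?case ..
  qed
  then show ?thesis by (metis run.simps)
qed

text \<open>Words act on functions on states by pulling back along \<open>run\<close>, with value zero where
  the word cannot be read. Acting on functions rather than on formal combinations of states turns
  reading \<open>u\<close> before \<open>v\<close> into the product \<open>u * v\<close> in its given order.\<close>

definition word_act :: "gen_word \<Rightarrow> (nat \<Rightarrow> 'k::comm_ring_1) \<Rightarrow> nat \<Rightarrow> 'k" where
  "word_act w f p = (case run w p of None \<Rightarrow> 0 | Some q \<Rightarrow> f q)"

definition act :: "'k::comm_ring_1 free_alg \<Rightarrow> (nat \<Rightarrow> 'k) \<Rightarrow> nat \<Rightarrow> 'k" where
  "act x f p = (\<Sum>w. Poly_Mapping.lookup x w * word_act w f p)"

lemma word_act_plus: "word_act (u + v) f p = word_act u (word_act v f) p"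
  by (simp add: word_act_def run_plus split: option.split)

lemma finite_act_support:
  "finite {w. Poly_Mapping.lookup x w * word_act w f p \<noteq> 0}"
  by (rule finite_subset[OF _ finite_lookup[of x]]) auto

lemma act_single: "act (Poly_Mapping.single w a) f p = a * word_act w f p"
proof -
  have "Poly_Mapping.lookup (Poly_Mapping.single w a) v * word_act v f p
      = (a * word_act w f p when v = w)" for v
    by (auto simp: lookup_single when_def)
  then show ?thesis by (simp add: act_def)
qed

lemma act_add: "act (x + y) f p = act x f p + act y f p"
  unfolding act_def lookup_add distrib_right
  by (rule Sum_any.distrib) (rule finite_act_support)+

lemma act_zero: "act 0 f p = 0"
  by (simp add: act_def)

lemma act_diff: "act (x - y) f p = act x f p - act y f p"
  using act_add[of "x - y" y f p] by simp

lemma act_zero_fun: "act x (\<lambda>_. 0) p = 0"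
proof -
  have "word_act w (\<lambda>_. 0) p = (0 :: 'a)" for w
    by (simp add: word_act_def split: option.split)
  then show ?thesis by (simp add: act_def)
qed

lemma act_add_fun: "act x (\<lambda>q. f q + g q) p = act x f p + act x g p"
proof -
  have "word_act w (\<lambda>q. f q + g q) p = word_act w f p + word_act w g p" for w
    by (simp add: word_act_def split: option.split)
  then show ?thesis
    unfolding act_def by (simp add: distrib_left Sum_any.distrib finite_act_support)
qed

lemma act_single_mult_single:
  "act (Poly_Mapping.single u a * Poly_Mapping.single v b) f p
    = act (Poly_Mapping.single u a) (act (Poly_Mapping.single v b) f) p"
  by (simp add: mult_single act_single word_act_plus)
    (simp add: word_act_def act_single split: option.split)

lemma act_single_mult:
  "act (Poly_Mapping.single u a * y) f p = act (Poly_Mapping.single u a) (act y f) p"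
proof (induction y rule: poly_mapping_single_induct)
  case (single v b)
  show ?case by (rule act_single_mult_single)
next
  case (sum y v b)
  have "act (y + Poly_Mapping.single v b) f
      = (\<lambda>q. act y f q + act (Poly_Mapping.single v b) f q)"
    by (rule ext) (rule act_add)
  with sum show ?case
    by (simp add: distrib_left act_add act_add_fun act_single_mult_single)
qed

lemma act_mult: "act (x * y) f p = act x (act y f) p"
  by (induction x rule: poly_mapping_single_induct)
    (simp_all add: act_single_mult distrib_right act_add)

lemma act_relators:
  assumes "r \<in> relators"
  shows "act r f p = 0"
  using assms run_list_relations[of p]
  by (auto simp: relators_def Let_def free_gen_def mult_single power2_eq_square power3_eq_cube
      act_diff act_single word_act_def simp del: run_list.simps)

lemma act_ideal: "x \<in> two_sided_ideal relators \<Longrightarrow> act x f p = 0"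
proof (induction arbitrary: f p rule: two_sided_ideal.induct)
  case zero
  show ?case by (rule act_zero)
next
  case (gen r)
  then show ?case by (rule act_relators)
next
  case (add x y)
  then show ?case by (simp add: act_add)
next
  case (mult x a b)
  have "act (x * b) f = (\<lambda>_. 0)" using mult.IH by (simp add: act_mult fun_eq_iff)
  then show ?case by (simp add: act_mult mult.assoc act_zero_fun)
qed

lift_definition alg_act :: "'k::comm_ring_1 presented_alg \<Rightarrow> (nat \<Rightarrow> 'k) \<Rightarrow> nat \<Rightarrow> 'k" is act
  unfolding rel_cong_def by (metis act_diff act_ideal ext right_minus_eq)

lemma alg_act_zero: "alg_act 0 f p = 0"
  by transfer (rule act_zero)

lemma alg_act_add: "alg_act (x + y) f p = alg_act x f p + alg_act y f p"
  by transfer (rule act_add)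

lemma alg_act_scale: "alg_act (alg_scale c x) f p = c * alg_act x f p"
proof transfer
  fix c :: 'a and x :: "'a free_alg" and f :: "nat \<Rightarrow> 'a" and p
  have "word_act 0 g p = g p" for g :: "nat \<Rightarrow> 'a"
    by (simp add: word_act_def zero_gen_word_def)
  then show "act (free_scale c x) f p = c * act x f p"
    by (simp add: free_scale_conv_mult act_mult act_single)
qed

definition delta :: "nat \<Rightarrow> nat \<Rightarrow> 'k::comm_ring_1" where
  "delta q p = (if p = q then 1 else 0)"

text \<open>A representative involves finitely many words, and each of them leads from \<open>0\<close> to at most one
  state.\<close>

lemma finite_reach: "finite {q. alg_act x (delta q) 0 \<noteq> 0}"
proof transfer
  fix x :: "'a free_alg"
  have "{q. act x (delta q) 0 \<noteq> 0} \<subseteq> (\<lambda>w. the (run w 0)) ` Poly_Mapping.keys x"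
  proof
    fix q
    assume "q \<in> {q. act x (delta q) 0 \<noteq> 0}"
    then obtain w where "Poly_Mapping.lookup x w * word_act w (delta q) 0 \<noteq> 0"
      unfolding act_def using Sum_any.not_neutral_obtains_not_neutral by blast
    then have "w \<in> Poly_Mapping.keys x" "run w 0 = Some q"
      by (auto simp: in_keys_iff word_act_def delta_def split: option.splits if_splits)
    then show "q \<in> (\<lambda>w. the (run w 0)) ` Poly_Mapping.keys x"
      by force
  qed
  then show "finite {q. act x (delta q) 0 \<noteq> 0}"
    by (rule finite_subset) simp
qed

lemma ex_alg_act_delta_nonzero: "\<exists>x :: 'k::comm_ring_1 presented_alg. alg_act x (delta q) 0 \<noteq> 0"
proof -
  obtain w where "run w 0 = Some q" using every_state_reachable by blast
  then have "act (Poly_Mapping.single w 1 :: 'k free_alg) (delta q) 0 \<noteq> 0"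
    by (simp add: act_single word_act_def delta_def)
  then show ?thesis by (metis alg_act.abs_eq)
qed

theorem proposition3p6:
  shows "\<not> finitely_generated_module
    (alg_scale :: 'k::comm_ring_1 \<Rightarrow> 'k presented_alg \<Rightarrow> 'k presented_alg)"
proof
  interpret module "alg_scale :: 'k \<Rightarrow> 'k presented_alg \<Rightarrow> 'k presented_alg"
    by (rule module_alg_scale)
  assume "finitely_generated_module (alg_scale :: 'k \<Rightarrow> 'k presented_alg \<Rightarrow> _)"
  then obtain B :: "'k presented_alg set" where "finite B" and span: "span B = UNIV"
    unfolding finitely_generated_module_def by blast
  then have "finite (\<Union>b\<in>B. {q. alg_act b (delta q) 0 \<noteq> 0})"
    using finite_reach by blast
  then obtain q where q: "\<And>b. b \<in> B \<Longrightarrow> alg_act b (delta q) 0 = 0"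
    using ex_new_if_finite[OF infinite_UNIV_nat] by blast
  have "subspace {x :: 'k presented_alg. alg_act x (delta q) 0 = 0}"
    by (rule subspaceI) (simp_all add: alg_act_zero alg_act_add alg_act_scale)
  then have "span B \<subseteq> {x. alg_act x (delta q) 0 = 0}"
    using q by (intro span_minimal) auto
  with span ex_alg_act_delta_nonzero[of q] show False by blast
qed

end
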